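(* (i) Let $p\neq 3$ be a prime number and let $G$ be a torsion-free group which is a residually finite $p$-group. Then $\mathbb{Q}[G]$ has no zero divisor whose support has size $3$. (ii) If $G$ is a residually finite $3$-group, then there is no zero divisor of the form $h_1-h_2+h_3$ in $\mathbb{Q}[G]$, where $h_1,h_2,h_3$ are pairwise distinct elements of $G$.
   Context: For a field $\mathbb{F}$ and a group $G$, the support of $\alpha=\sum_{g\in G}\alpha_g g\in \mathbb{F}[G]$ is $supp(\alpha)=\{g\in G : \alpha_g\neq 0\}$. A non-zero element $\alpha\in \mathbb{F}[G]$ is called a zero divisor if $\alpha\beta=0$ for some non-zero $\beta\in \mathbb{F}[G]$. A group $G$ is a residually finite $p$-group if for every $1\neq g\in G$ there is a normal subgroup $N$ of $G$ with $g\notin N$ and $G/N$ a finite $p$-group. *)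

theory Defs
  imports Complex_Main "HOL-Algebra.Coset" "HOL-Algebra.Ring" "HOL-Computational_Algebra.Primes"
begin

definition supp :: "('g \<Rightarrow> 'k::zero) \<Rightarrow> 'g set" where
  "supp \<alpha> = {g. \<alpha> g \<noteq> 0}"

text \<open>
  The element \<open>\<Sum>\<^sub>g \<alpha>\<^sub>g g\<close> of the group algebra is represented by its coefficient function, which is
  required to vanish outside \<open>carrier G\<close>, so that equality of elements is equality of functions.
  The product is the bilinear extension of the multiplication of \<open>G\<close>.
\<close>

definition group_algebra :: "('g, 'm) monoid_scheme \<Rightarrow> ('g \<Rightarrow> 'k::field) ring" where
  "group_algebra G =
    \<lparr>carrier = {\<alpha>. finite (supp \<alpha>) \<and> supp \<alpha> \<subseteq> carrier G},
     monoid.mult = (\<lambda>\<alpha> \<beta> x. \<Sum>g\<in>supp \<alpha>. \<Sum>h\<in>supp \<beta>. if g \<otimes>\<^bsub>G\<^esub> h = x then \<alpha> g * \<beta> h else 0),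
     one = (\<lambda>x. if x = \<one>\<^bsub>G\<^esub> then 1 else 0),
     zero = (\<lambda>x. 0),
     add = (\<lambda>\<alpha> \<beta> x. \<alpha> x + \<beta> x)\<rparr>"

definition basis_elt :: "'g \<Rightarrow> 'g \<Rightarrow> 'k::zero_neq_one" where
  "basis_elt g = (\<lambda>x. if x = g then 1 else 0)"

definition zero_divisor :: "('a, 'm) ring_scheme \<Rightarrow> 'a \<Rightarrow> bool" where
  "zero_divisor R a \<longleftrightarrow>
    a \<in> carrier R \<and> a \<noteq> \<zero>\<^bsub>R\<^esub> \<and> (\<exists>b\<in>carrier R. b \<noteq> \<zero>\<^bsub>R\<^esub> \<and> a \<otimes>\<^bsub>R\<^esub> b = \<zero>\<^bsub>R\<^esub>)"

definition torsion_free :: "('g, 'm) monoid_scheme \<Rightarrow> bool" where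
  "torsion_free G \<longleftrightarrow>
    (\<forall>g\<in>carrier G. g \<noteq> \<one>\<^bsub>G\<^esub> \<longrightarrow> (\<forall>n::nat. n > 0 \<longrightarrow> g [^]\<^bsub>G\<^esub> n \<noteq> \<one>\<^bsub>G\<^esub>))"

definition finite_p_group :: "nat \<Rightarrow> ('g, 'm) monoid_scheme \<Rightarrow> bool" where
  "finite_p_group p G \<longleftrightarrow> group G \<and> finite (carrier G) \<and> (\<exists>n. order G = p ^ n)"

definition residually_finite_p_group :: "nat \<Rightarrow> ('g, 'm) monoid_scheme \<Rightarrow> bool" where
  "residually_finite_p_group p G \<longleftrightarrow>
    group G \<and>
    (\<forall>g\<in>carrier G. g \<noteq> \<one>\<^bsub>G\<^esub> \<longrightarrow> (\<exists>N. N \<lhd> G \<and> g \<notin> N \<and> finite_p_group p (G Mod N)))"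

lemma group_algebra_simps:
  "carrier (group_algebra G) = {\<alpha>. finite (supp \<alpha>) \<and> supp \<alpha> \<subseteq> carrier G}"
  "\<alpha> \<otimes>\<^bsub>group_algebra G\<^esub> \<beta> =
    (\<lambda>x. \<Sum>g\<in>supp \<alpha>. \<Sum>h\<in>supp \<beta>. if g \<otimes>\<^bsub>G\<^esub> h = x then \<alpha> g * \<beta> h else 0)"
  "\<one>\<^bsub>group_algebra G\<^esub> = basis_elt \<one>\<^bsub>G\<^esub>"
  "\<zero>\<^bsub>group_algebra G\<^esub> = (\<lambda>x. 0)"
  "\<alpha> \<oplus>\<^bsub>group_algebra G\<^esub> \<beta> = (\<lambda>x. \<alpha> x + \<beta> x)"
  by (simp_all add: group_algebra_def basis_elt_def)

lemma group_algebra_mult_superset: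
  assumes "finite A" "supp \<alpha> \<subseteq> A" "finite B" "supp \<beta> \<subseteq> B"
  shows "(\<alpha> \<otimes>\<^bsub>group_algebra G\<^esub> \<beta>) x =
    (\<Sum>g\<in>A. \<Sum>h\<in>B. if g \<otimes>\<^bsub>G\<^esub> h = x then \<alpha> g * \<beta> h else 0)"
proof -
  have "(\<Sum>h\<in>B. if g \<otimes>\<^bsub>G\<^esub> h = x then \<alpha> g * \<beta> h else 0) =
        (\<Sum>h\<in>supp \<beta>. if g \<otimes>\<^bsub>G\<^esub> h = x then \<alpha> g * \<beta> h else 0)" for g
    by (rule sum.mono_neutral_right) (use assms in \<open>auto simp: supp_def\<close>)
  moreover have "(\<Sum>g\<in>A. \<Sum>h\<in>supp \<beta>. if g \<otimes>\<^bsub>G\<^esub> h = x then \<alpha> g * \<beta> h else 0) =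
        (\<Sum>g\<in>supp \<alpha>. \<Sum>h\<in>supp \<beta>. if g \<otimes>\<^bsub>G\<^esub> h = x then \<alpha> g * \<beta> h else 0)"
    by (rule sum.mono_neutral_right) (use assms in \<open>auto simp: supp_def cong: if_cong\<close>)
  ultimately show ?thesis by (simp add: group_algebra_simps)
qed

lemma supp_group_algebra_mult:
  "supp (\<alpha> \<otimes>\<^bsub>group_algebra G\<^esub> \<beta>) \<subseteq> (\<lambda>(g, h). g \<otimes>\<^bsub>G\<^esub> h) ` (supp \<alpha> \<times> supp \<beta>)"
proof
  fix x assume x: "x \<in> supp (\<alpha> \<otimes>\<^bsub>group_algebra G\<^esub> \<beta>)"
  show "x \<in> (\<lambda>(g, h). g \<otimes>\<^bsub>G\<^esub> h) ` (supp \<alpha> \<times> supp \<beta>)"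
  proof (rule ccontr)
    assume "x \<notin> (\<lambda>(g, h). g \<otimes>\<^bsub>G\<^esub> h) ` (supp \<alpha> \<times> supp \<beta>)"
    then have "g \<otimes>\<^bsub>G\<^esub> h \<noteq> x" if "g \<in> supp \<alpha>" "h \<in> supp \<beta>" for g h
      using that by force
    then have "(\<alpha> \<otimes>\<^bsub>group_algebra G\<^esub> \<beta>) x = 0"
      by (simp add: group_algebra_simps)
    with x show False by (simp add: supp_def)
  qed
qed

lemma group_algebra_mult_assoc:
  assumes "group G" and "\<alpha> \<in> carrier (group_algebra G)" "\<beta> \<in> carrier (group_algebra G)"
    "\<gamma> \<in> carrier (group_algebra G)"
  shows "(\<alpha> \<otimes>\<^bsub>group_algebra G\<^esub> \<beta>) \<otimes>\<^bsub>group_algebra G\<^esub> \<gamma> =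
         \<alpha> \<otimes>\<^bsub>group_algebra G\<^esub> (\<beta> \<otimes>\<^bsub>group_algebra G\<^esub> \<gamma>)"
proof
  fix x
  interpret group G by fact
  define A B C where "A = supp \<alpha>" and "B = supp \<beta>" and "C = supp \<gamma>"
  have fin: "finite A" "finite B" "finite C" and sub: "A \<subseteq> carrier G" "B \<subseteq> carrier G" "C \<subseteq> carrier G"
    using assms by (auto simp: group_algebra_simps A_def B_def C_def)
  define AB where "AB = (\<lambda>(g, h). g \<otimes>\<^bsub>G\<^esub> h) ` (A \<times> B)"
  define BC where "BC = (\<lambda>(g, h). g \<otimes>\<^bsub>G\<^esub> h) ` (B \<times> C)"
  have fin': "finite AB" "finite BC" using fin by (auto simp: AB_def BC_def)
  have "((\<alpha> \<otimes>\<^bsub>group_algebra G\<^esub> \<beta>) \<otimes>\<^bsub>group_algebra G\<^esub> \<gamma>) x =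
     (\<Sum>u\<in>AB. \<Sum>c\<in>C. if u \<otimes>\<^bsub>G\<^esub> c = x then (\<alpha> \<otimes>\<^bsub>group_algebra G\<^esub> \<beta>) u * \<gamma> c else 0)"
    by (rule group_algebra_mult_superset)
       (use fin fin' supp_group_algebra_mult[of G \<alpha> \<beta>] in \<open>simp_all add: AB_def A_def B_def C_def\<close>)
  also have "\<dots> = (\<Sum>u\<in>AB. \<Sum>c\<in>C. \<Sum>a\<in>A. \<Sum>b\<in>B.
      if a \<otimes>\<^bsub>G\<^esub> b = u then (if u \<otimes>\<^bsub>G\<^esub> c = x then \<alpha> a * \<beta> b * \<gamma> c else 0) else 0)"
    by (intro sum.cong refl)
       (auto simp: group_algebra_simps A_def B_def sum_distrib_right intro!: sum.cong cong: if_cong)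
  also have "\<dots> = (\<Sum>c\<in>C. \<Sum>a\<in>A. \<Sum>b\<in>B. \<Sum>u\<in>AB.
      if a \<otimes>\<^bsub>G\<^esub> b = u then (if u \<otimes>\<^bsub>G\<^esub> c = x then \<alpha> a * \<beta> b * \<gamma> c else 0) else 0)"
    by (rule trans[OF sum.swap], rule sum.cong[OF refl], rule trans[OF sum.swap], rule sum.cong[OF refl], rule sum.swap)
  also have "\<dots> = (\<Sum>c\<in>C. \<Sum>a\<in>A. \<Sum>b\<in>B.
      if (a \<otimes>\<^bsub>G\<^esub> b) \<otimes>\<^bsub>G\<^esub> c = x then \<alpha> a * \<beta> b * \<gamma> c else 0)"
    using fin' by (intro sum.cong refl) (auto simp: sum.delta' AB_def)
  also have "\<dots> = (\<Sum>a\<in>A. \<Sum>b\<in>B. \<Sum>c\<in>C.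
      if a \<otimes>\<^bsub>G\<^esub> (b \<otimes>\<^bsub>G\<^esub> c) = x then \<alpha> a * (\<beta> b * \<gamma> c) else 0)"
    by (rule trans[OF sum.swap], rule sum.cong[OF refl], rule trans[OF sum.swap], rule sum.cong[OF refl],
        rule sum.cong[OF refl])
       (use sub in \<open>auto simp: m_assoc subset_iff mult.assoc\<close>)
  also have "\<dots> = (\<Sum>a\<in>A. \<Sum>b\<in>B. \<Sum>c\<in>C. \<Sum>v\<in>BC.
      if b \<otimes>\<^bsub>G\<^esub> c = v then (if a \<otimes>\<^bsub>G\<^esub> v = x then \<alpha> a * (\<beta> b * \<gamma> c) else 0) else 0)"
    using fin' by (intro sum.cong refl) (auto simp: sum.delta' BC_def)
  also have "\<dots> = (\<Sum>a\<in>A. \<Sum>v\<in>BC. \<Sum>b\<in>B. \<Sum>c\<in>C.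
      if b \<otimes>\<^bsub>G\<^esub> c = v then (if a \<otimes>\<^bsub>G\<^esub> v = x then \<alpha> a * (\<beta> b * \<gamma> c) else 0) else 0)"
    by (rule sum.cong[OF refl], rule trans[OF _ sum.swap], rule sum.cong[OF refl], rule sum.swap)
  also have "\<dots> = (\<Sum>a\<in>A. \<Sum>v\<in>BC.
      if a \<otimes>\<^bsub>G\<^esub> v = x then \<alpha> a * (\<beta> \<otimes>\<^bsub>group_algebra G\<^esub> \<gamma>) v else 0)"
    by (intro sum.cong refl)
       (auto simp: group_algebra_simps B_def C_def sum_distrib_left intro!: sum.cong cong: if_cong)
  also have "\<dots> = (\<alpha> \<otimes>\<^bsub>group_algebra G\<^esub> (\<beta> \<otimes>\<^bsub>group_algebra G\<^esub> \<gamma>)) x"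
    by (rule group_algebra_mult_superset[symmetric])
       (use fin fin' supp_group_algebra_mult[of G \<beta> \<gamma>] in \<open>simp_all add: BC_def A_def B_def C_def\<close>)
  finally show "((\<alpha> \<otimes>\<^bsub>group_algebra G\<^esub> \<beta>) \<otimes>\<^bsub>group_algebra G\<^esub> \<gamma>) x =
      (\<alpha> \<otimes>\<^bsub>group_algebra G\<^esub> (\<beta> \<otimes>\<^bsub>group_algebra G\<^esub> \<gamma>)) x" .
qed

lemma supp_add_subset: "supp (\<lambda>x. \<alpha> x + \<beta> x :: 'k::field) \<subseteq> supp \<alpha> \<union> supp \<beta>"
  by (auto simp: supp_def)

lemma abelian_group_group_algebra:
  "abelian_group (group_algebra G :: ('g \<Rightarrow> 'k::field) ring)"
proof (rule abelian_groupI)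
  fix \<alpha> \<beta> :: "'g \<Rightarrow> 'k"
  assume "\<alpha> \<in> carrier (group_algebra G)" "\<beta> \<in> carrier (group_algebra G)"
  then show "\<alpha> \<oplus>\<^bsub>group_algebra G\<^esub> \<beta> \<in> carrier (group_algebra G)"
    using supp_add_subset[of \<alpha> \<beta>]
    by (auto simp: group_algebra_simps dest: finite_subset)
next
  fix \<alpha> :: "'g \<Rightarrow> 'k"
  assume "\<alpha> \<in> carrier (group_algebra G)"
  then have "(\<lambda>x. - \<alpha> x) \<in> carrier (group_algebra G)"
    by (auto simp: group_algebra_simps supp_def)
  then show "\<exists>\<beta>\<in>carrier (group_algebra G). \<beta> \<oplus>\<^bsub>group_algebra G\<^esub> \<alpha> = \<zero>\<^bsub>group_algebra G\<^esub>"
    by (rule bexI[rotated]) (auto simp: group_algebra_simps)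
qed (auto simp: group_algebra_simps supp_def algebra_simps)

lemma ring_group_algebra:
  assumes "group G"
  shows "ring (group_algebra G :: ('g \<Rightarrow> 'k::field) ring)"
proof (rule ringI)
  interpret group G by fact
  let ?R = "group_algebra G :: ('g \<Rightarrow> 'k) ring"
  show "abelian_group ?R" by (rule abelian_group_group_algebra)
  show "monoid ?R"
  proof (rule monoidI)
    fix \<alpha> \<beta> assume ab: "\<alpha> \<in> carrier ?R" "\<beta> \<in> carrier ?R"
    have "finite (supp (\<alpha> \<otimes>\<^bsub>?R\<^esub> \<beta>))"
      using ab by (intro finite_subset[OF supp_group_algebra_mult]) (auto simp: group_algebra_simps(1))
    moreover have "supp (\<alpha> \<otimes>\<^bsub>?R\<^esub> \<beta>) \<subseteq> carrier G"
      using ab by (intro order_trans[OF supp_group_algebra_mult]) (auto simp: group_algebra_simps(1))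
    ultimately show "\<alpha> \<otimes>\<^bsub>?R\<^esub> \<beta> \<in> carrier ?R" by (simp add: group_algebra_simps(1))
  next
    show "\<one>\<^bsub>?R\<^esub> \<in> carrier ?R" by (auto simp: group_algebra_simps supp_def basis_elt_def)
  next
    fix \<alpha> assume a: "\<alpha> \<in> carrier ?R"
    then have fin: "finite (supp \<alpha>)" and sub: "supp \<alpha> \<subseteq> carrier G" by (auto simp: group_algebra_simps)
    have s: "supp (basis_elt \<one>\<^bsub>G\<^esub> :: 'g \<Rightarrow> 'k) = {\<one>\<^bsub>G\<^esub>}" by (auto simp: supp_def basis_elt_def)
    have e: "(\<Sum>h\<in>supp \<alpha>. if h = x then \<alpha> h else 0) = \<alpha> x" for x
      using fin by (auto simp: supp_def)
    show "\<one>\<^bsub>?R\<^esub> \<otimes>\<^bsub>?R\<^esub> \<alpha> = \<alpha>"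
    proof
      fix x
      have "(\<one>\<^bsub>?R\<^esub> \<otimes>\<^bsub>?R\<^esub> \<alpha>) x = (\<Sum>h\<in>supp \<alpha>. if h = x then \<alpha> h else 0)"
        unfolding group_algebra_simps(3)
          group_algebra_mult_superset[OF finite.insertI[OF finite.emptyI] equalityD1[OF s] fin order_refl]
        using sub by (auto simp: basis_elt_def intro!: sum.cong)
      then show "(\<one>\<^bsub>?R\<^esub> \<otimes>\<^bsub>?R\<^esub> \<alpha>) x = \<alpha> x" by (simp add: e)
    qed
    show "\<alpha> \<otimes>\<^bsub>?R\<^esub> \<one>\<^bsub>?R\<^esub> = \<alpha>"
    proof
      fix x
      have "(\<alpha> \<otimes>\<^bsub>?R\<^esub> \<one>\<^bsub>?R\<^esub>) x = (\<Sum>h\<in>supp \<alpha>. if h = x then \<alpha> h else 0)"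
        unfolding group_algebra_simps(3)
          group_algebra_mult_superset[OF fin order_refl finite.insertI[OF finite.emptyI] equalityD1[OF s]]
        using sub by (auto simp: basis_elt_def intro!: sum.cong)
      then show "(\<alpha> \<otimes>\<^bsub>?R\<^esub> \<one>\<^bsub>?R\<^esub>) x = \<alpha> x" by (simp add: e)
    qed
  qed (use assms in \<open>rule group_algebra_mult_assoc\<close>)
next
  interpret group G by fact
  let ?R = "group_algebra G :: ('g \<Rightarrow> 'k) ring"
  fix \<alpha> \<beta> \<gamma> assume "\<alpha> \<in> carrier ?R" "\<beta> \<in> carrier ?R" "\<gamma> \<in> carrier ?R"
  then have fin: "finite (supp \<alpha>)" "finite (supp \<beta>)" "finite (supp \<gamma>)"
    by (auto simp: group_algebra_simps)
  define U where "U = supp \<alpha> \<union> supp \<beta>"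
  have U: "finite U" "supp \<alpha> \<subseteq> U" "supp \<beta> \<subseteq> U" "supp (\<alpha> \<oplus>\<^bsub>?R\<^esub> \<beta>) \<subseteq> U"
    using fin supp_add_subset[of \<alpha> \<beta>] by (auto simp: U_def group_algebra_simps)
  show "(\<alpha> \<oplus>\<^bsub>?R\<^esub> \<beta>) \<otimes>\<^bsub>?R\<^esub> \<gamma> = \<alpha> \<otimes>\<^bsub>?R\<^esub> \<gamma> \<oplus>\<^bsub>?R\<^esub> \<beta> \<otimes>\<^bsub>?R\<^esub> \<gamma>"
  proof
    fix x
    note m = group_algebra_mult_superset[OF U(1) _ fin(3) order_refl, where G = G and x = x]
    have "(\<alpha> \<otimes>\<^bsub>?R\<^esub> \<gamma> \<oplus>\<^bsub>?R\<^esub> \<beta> \<otimes>\<^bsub>?R\<^esub> \<gamma>) x = (\<alpha> \<otimes>\<^bsub>?R\<^esub> \<gamma>) x + (\<beta> \<otimes>\<^bsub>?R\<^esub> \<gamma>) x"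
      by (simp add: group_algebra_simps(5))
    also have "\<dots> = ((\<alpha> \<oplus>\<^bsub>?R\<^esub> \<beta>) \<otimes>\<^bsub>?R\<^esub> \<gamma>) x"
      unfolding m[OF U(2)] m[OF U(3)] m[OF U(4)] sum.distrib[symmetric]
      by (intro sum.cong refl) (simp add: group_algebra_simps(5) algebra_simps)
    finally show "((\<alpha> \<oplus>\<^bsub>?R\<^esub> \<beta>) \<otimes>\<^bsub>?R\<^esub> \<gamma>) x = (\<alpha> \<otimes>\<^bsub>?R\<^esub> \<gamma> \<oplus>\<^bsub>?R\<^esub> \<beta> \<otimes>\<^bsub>?R\<^esub> \<gamma>) x" ..
  qed
  show "\<gamma> \<otimes>\<^bsub>?R\<^esub> (\<alpha> \<oplus>\<^bsub>?R\<^esub> \<beta>) = \<gamma> \<otimes>\<^bsub>?R\<^esub> \<alpha> \<oplus>\<^bsub>?R\<^esub> \<gamma> \<otimes>\<^bsub>?R\<^esub> \<beta>"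
  proof
    fix x
    note m = group_algebra_mult_superset[OF fin(3) order_refl U(1), where G = G and x = x]
    have "(\<gamma> \<otimes>\<^bsub>?R\<^esub> \<alpha> \<oplus>\<^bsub>?R\<^esub> \<gamma> \<otimes>\<^bsub>?R\<^esub> \<beta>) x = (\<gamma> \<otimes>\<^bsub>?R\<^esub> \<alpha>) x + (\<gamma> \<otimes>\<^bsub>?R\<^esub> \<beta>) x"
      by (simp add: group_algebra_simps(5))
    also have "\<dots> = (\<gamma> \<otimes>\<^bsub>?R\<^esub> (\<alpha> \<oplus>\<^bsub>?R\<^esub> \<beta>)) x"
      unfolding m[OF U(2)] m[OF U(3)] m[OF U(4)] sum.distrib[symmetric]
      by (intro sum.cong refl) (simp add: group_algebra_simps(5) algebra_simps)
    finally show "(\<gamma> \<otimes>\<^bsub>?R\<^esub> (\<alpha> \<oplus>\<^bsub>?R\<^esub> \<beta>)) x = (\<gamma> \<otimes>\<^bsub>?R\<^esub> \<alpha> \<oplus>\<^bsub>?R\<^esub> \<gamma> \<otimes>\<^bsub>?R\<^esub> \<beta>) x" ..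
  qed
qed

end

theory Submission
  imports Defs "HOL-Algebra.Group_Action" "HOL-Algebra.Elementary_Groups" "HOL-Number_Theory.Cong"
begin

text \<open>
  The augmentation of an element is the sum of its coefficients. Suppose that \<open>\<alpha> \<beta> = 0\<close> with
  \<open>\<alpha>\<close> and \<open>\<beta>\<close> nonzero in the rational group algebra. After multiplication by suitable rational
  numbers both have integer coefficients without a common factor; in particular \<open>\<beta>\<close> remains
  nonzero modulo every prime. Two kinds of reduction modulo a prime then constrain \<open>\<alpha>\<close>.

  If \<open>G\<close> is a residually finite \<open>p\<close>-group, reduce modulo \<open>p\<close> and pass to a finite \<open>p\<close>-quotient
  in which a chosen element of the support of \<open>\<beta>\<close> stays apart from the others. In the group algebra
  of a finite \<open>p\<close>-group in characteristic \<open>p\<close>, an element of nonzero augmentation is a unit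
  (\<open>finite_p_group_dvd_of_translates\<close> gives the part of this that is needed). Hence \<open>p\<close> divides
  the augmentation of \<open>\<alpha>\<close> (\<open>zero_divisor_prime_dvd_augmentation\<close>). For \<open>h1 - h2 + h3\<close> the
  augmentation is \<open>1\<close>, and the second claim follows.

  If \<open>G\<close> is torsion-free, reduce modulo an arbitrary prime \<open>q\<close>. An element with one or two terms is
  not a zero divisor over any field, so the number of coefficients of \<open>\<alpha>\<close> prime to \<open>q\<close> is neither
  \<open>1\<close> nor \<open>2\<close> (\<open>zero_divisor_card_coprime_coeffs\<close>). When \<open>\<alpha>\<close> has three terms, all three are
  therefore prime to every \<open>q\<close>, that is, equal to \<open>1\<close> or \<open>-1\<close>. The augmentation of \<open>\<alpha>\<close> is then
  \<open>1\<close>, \<open>-1\<close>, \<open>3\<close> or \<open>-3\<close>, which a prime \<open>p \<noteq> 3\<close> does not divide. So the first claim follows too.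
\<close>

section \<open>Counting moved points under a finite p-group\<close>

lemma group_action_restrictI:
  fixes G (structure)
  assumes "group G"
    and closed: "\<And>g x. g \<in> carrier G \<Longrightarrow> x \<in> E \<Longrightarrow> \<phi> g x \<in> E"
    and one: "\<And>x. x \<in> E \<Longrightarrow> \<phi> \<one> x = x"
    and mult: "\<And>g h x. g \<in> carrier G \<Longrightarrow> h \<in> carrier G \<Longrightarrow> x \<in> E \<Longrightarrow> \<phi> (g \<otimes> h) x = \<phi> g (\<phi> h x)"
  shows "group_action G E (\<lambda>g. restrict (\<phi> g) E)"
proof -
  interpret group G by fact
  have cancel: "\<phi> (inv g) (\<phi> g x) = x" "\<phi> g (\<phi> (inv g) x) = x" if "g \<in> carrier G" "x \<in> E" for g x
    using that one mult[of "inv g" g x] mult[of g "inv g" x] by simp_all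
  have bij: "restrict (\<phi> g) E \<in> Bij E" if g: "g \<in> carrier G" for g
  proof -
    have "bij_betw (\<phi> g) E E"
      by (rule bij_betw_byWitness[where f' = "\<phi> (inv g)"]) (use g closed cancel in auto)
    then show ?thesis
      by (simp add: Bij_def bij_betw_def inj_on_def)
  qed
  have "(\<lambda>g. restrict (\<phi> g) E) \<in> hom G (BijGroup E)"
  proof (rule homI)
    fix g h assume gh: "g \<in> carrier G" "h \<in> carrier G"
    have "restrict (\<phi> (g \<otimes> h)) E = compose E (restrict (\<phi> g) E) (restrict (\<phi> h) E)"
      using gh closed mult by (auto simp: compose_def fun_eq_iff)
    then show "restrict (\<phi> (g \<otimes> h)) E = restrict (\<phi> g) E \<otimes>\<^bsub>BijGroup E\<^esub> restrict (\<phi> h) E"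
      using gh bij by (simp add: BijGroup_def)
  qed (use bij in \<open>simp add: BijGroup_def\<close>)
  then show ?thesis
    by (simp add: group_action_def group_hom_def group_hom_axioms_def group_BijGroup is_group)
qed

text \<open>
  The orbit of a moved point has more than one element and its size divides a power of \<open>p\<close>, so
  \<open>p\<close> divides it; an orbit consists either of moved points only or of a single fixed point.
\<close>
lemma (in group_action) p_group_dvd_card_moved_points:
  assumes "prime p" "order G = p ^ n" "finite E"
  shows "p dvd card {x \<in> E. \<exists>g\<in>carrier G. \<phi> g x \<noteq> x}"
proof -
  define moved where "moved x \<longleftrightarrow> (\<exists>g\<in>carrier G. \<phi> g x \<noteq> x)" for x
  have "p dvd (\<Sum>x\<in>orb. if moved x then 1 else 0)" if orb: "orb \<in> orbits G E \<phi>" for orb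
  proof -
    obtain x where x: "x \<in> E" "orb = orbit G \<phi> x"
      using orb by (auto simp: orbits_def)
    have sub: "orb \<subseteq> E" using orb orbits_coverture by auto
    have fin: "finite orb" using sub assms(3) by (rule finite_subset)
    have x_orb: "x \<in> orb" using x orbit_refl by simp
    show ?thesis
    proof (cases "card orb = 1")
      case True
      then have orb: "orb = {x}" using x_orb by (metis card_1_singletonE singletonD)
      have "\<not> moved x"
        using orb unfolding x(2) moved_def by (auto simp: orbit_def)
      then show ?thesis by (simp add: orb)
    next
      case False
      have "moved y" if "y \<in> orb" for y
      proof (rule ccontr)
        assume "\<not> moved y"
        then have "orbit G \<phi> y \<subseteq> {y}" by (auto simp: moved_def orbit_def)
        moreover have "orb \<subseteq> orbit G \<phi> y"
          using that x sub orbit_sym orbit_trans by blast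
        ultimately have "orb = {y}" using that by blast
        with False show False by simp
      qed
      then have "(\<Sum>x\<in>orb. if moved x then 1 else 0) = card orb" by simp
      moreover have "card orb dvd p ^ n"
        using orbit_stabilizer_theorem[OF x(1)] x(2) assms(2) by (metis dvd_triv_left)
      then obtain i where "card orb = p ^ i"
        using assms(1) divides_primepow_nat by blast
      with False have "p dvd card orb" by (cases i) auto
      ultimately show ?thesis by simp
    qed
  qed
  then have "p dvd (\<Sum>x\<in>E. if moved x then 1 else 0)"
    unfolding disjoint_sum[OF assms(3), symmetric] by (rule dvd_sum)
  also have "(\<Sum>x\<in>E. if moved x then 1 else 0) = card {x \<in> E. moved x}"
    using assms(3) by (simp add: sum.If_cases Int_def)
  finally show ?thesis by (simp add: moved_def)
qed

text \<open>
  The same count for an action given by plain maps. The restriction to \<open>E\<close> that an action in the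
  sense of \<^locale>\<open>group_action\<close> requires does not affect which points of \<open>E\<close> are moved.
\<close>
lemma p_group_dvd_card_moved_points_of_maps:
  fixes G (structure)
  assumes "group G" "prime p" "order G = p ^ n" "finite E"
    and closed: "\<And>g x. g \<in> carrier G \<Longrightarrow> x \<in> E \<Longrightarrow> \<phi> g x \<in> E"
    and one: "\<And>x. x \<in> E \<Longrightarrow> \<phi> \<one> x = x"
    and mult: "\<And>g h x. g \<in> carrier G \<Longrightarrow> h \<in> carrier G \<Longrightarrow> x \<in> E \<Longrightarrow> \<phi> (g \<otimes> h) x = \<phi> g (\<phi> h x)"
  shows "p dvd card {x \<in> E. \<exists>g\<in>carrier G. \<phi> g x \<noteq> x}"
proof -
  interpret group_action G E "\<lambda>g. restrict (\<phi> g) E"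
    using assms(1) closed one mult by (rule group_action_restrictI)
  have "p dvd card {x \<in> E. \<exists>g\<in>carrier G. restrict (\<phi> g) E x \<noteq> x}"
    using assms by (intro p_group_dvd_card_moved_points)
  also have "{x \<in> E. \<exists>g\<in>carrier G. restrict (\<phi> g) E x \<noteq> x} = {x \<in> E. \<exists>g\<in>carrier G. \<phi> g x \<noteq> x}"
    by auto
  finally show ?thesis .
qed

section \<open>Units in the group algebra of a finite p-group modulo p\<close>

text \<open>
  An element of the group algebra of \<open>P\<close> over the field with \<open>p\<close> elements whose augmentation is
  nonzero is not a left zero divisor. The usual reason is that the augmentation ideal is nilpotent;
  a count in the set \<open>K\<close> of all functions annihilated by \<open>\<Sum>i\<in>I. a i * u i\<close> does instead. If \<open>p\<close>
  does not divide every value of \<open>f\<close>, then the additive group of order \<open>p\<close> acts on \<open>K\<close> by adding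
  multiples of \<open>f\<close> modulo \<open>p\<close>, without fixed points, so \<open>p\<close> divides the size of \<open>K\<close>. On the other
  hand right translation by \<open>P\<close> commutes with multiplication from the left and hence preserves \<open>K\<close>.
  Its fixed points are the constant functions in \<open>K\<close>, and since the annihilating element
  multiplies a constant by its augmentation, \<open>0\<close> is the only one. So the size of \<open>K\<close> is also \<open>1\<close>
  modulo \<open>p\<close>.
\<close>
lemma finite_p_group_dvd_of_translates:
  fixes P (structure) and f :: "'a \<Rightarrow> int" and a :: "'i \<Rightarrow> int"
  assumes p: "prime p" and P: "finite_p_group p P"
    and u: "\<And>i. i \<in> I \<Longrightarrow> u i \<in> carrier P"
    and unit: "\<not> int p dvd (\<Sum>i\<in>I. a i)"
    and f: "\<And>c. c \<in> carrier P \<Longrightarrow> int p dvd (\<Sum>i\<in>I. a i * f (inv (u i) \<otimes> c))"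
    and c: "c \<in> carrier P"
  shows "int p dvd f c"
proof (rule ccontr)
  assume fc: "\<not> int p dvd f c"
  interpret group P using P by (simp add: finite_p_group_def)
  have finP: "finite (carrier P)" using P by (simp add: finite_p_group_def)
  obtain n where n: "order P = p ^ n" using P by (auto simp: finite_p_group_def)
  have p1: "p > 1" using p by (rule prime_gt_1_nat)
  define T where "T k c = (\<Sum>i\<in>I. a i * k (inv (u i) \<otimes> c))" for k :: "'a \<Rightarrow> int" and c
  \<comment> \<open>Elements of the prime field are represented by their residues in \<open>{0..<p}\<close>, and functions are
     extensional, so that \<open>K\<close> is finite and congruent functions are equal.\<close>
  define K where "K = {k \<in> carrier P \<rightarrow>\<^sub>E {0..<int p}. \<forall>c\<in>carrier P. int p dvd T k c}"
  have finK: "finite K"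
    unfolding K_def by (rule finite_subset[of _ "carrier P \<rightarrow>\<^sub>E {0..<int p}"]) (auto intro: finite_PiE finP)
  have range: "0 \<le> k x" "k x < int p" if "k \<in> K" "x \<in> carrier P" for k x
    using that by (auto simp: K_def PiE_def Pi_def)
  have ext: "restrict k (carrier P) = k" if "k \<in> K" for k
    using that by (auto simp: K_def PiE_def extensional_restrict)
  \<comment> \<open>Adding multiples of \<open>f\<close> moves every point of \<open>K\<close>.\<close>
  have "p dvd card {k \<in> K. \<exists>j\<in>carrier (integer_mod_group p).
      restrict (\<lambda>c. (k c + j * f c) mod int p) (carrier P) \<noteq> k}"
  proof (rule p_group_dvd_card_moved_points_of_maps[where n = 1])
    show "order (integer_mod_group p) = p ^ 1"
      using p1 by (simp add: order_def carrier_integer_mod_group)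
  next
    fix j k assume k: "k \<in> K"
    let ?k = "restrict (\<lambda>c. (k c + j * f c) mod int p) (carrier P)"
    have "int p dvd T ?k d" if d: "d \<in> carrier P" for d
    proof -
      have "T ?k d = (\<Sum>i\<in>I. a i * ((k (inv (u i) \<otimes> d) + j * f (inv (u i) \<otimes> d)) mod int p))"
        unfolding T_def using u d by (intro sum.cong) auto
      also have "[\<dots> = (\<Sum>i\<in>I. a i * (k (inv (u i) \<otimes> d) + j * f (inv (u i) \<otimes> d)))] (mod int p)"
        by (intro cong_sum cong_mult cong_refl) (simp add: cong_def)
      also have "(\<Sum>i\<in>I. a i * (k (inv (u i) \<otimes> d) + j * f (inv (u i) \<otimes> d))) = T k d + j * T f d"
        by (simp add: T_def sum.distrib sum_distrib_left algebra_simps)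
      finally have "int p dvd T ?k d \<longleftrightarrow> int p dvd T k d + j * T f d" by (rule cong_dvd_iff)
      then show ?thesis using k d f by (auto simp: K_def T_def)
    qed
    then show "?k \<in> K" using p1 by (auto simp: K_def)
  next
    fix k assume k: "k \<in> K"
    have "restrict (\<lambda>c. (k c + \<one>\<^bsub>integer_mod_group p\<^esub> * f c) mod int p) (carrier P) = restrict k (carrier P)"
      by (rule restrict_ext) (use range[OF k] in simp)
    then show "restrict (\<lambda>c. (k c + \<one>\<^bsub>integer_mod_group p\<^esub> * f c) mod int p) (carrier P) = k"
      using ext[OF k] by simp
  next
    fix i j k
    have "(k x + (i + j) mod int p * f x) mod int p = ((k x + j * f x) mod int p + i * f x) mod int p" for x
    proof -
      have "(k x + (i + j) mod int p * f x) mod int p = (k x + (i + j) * f x) mod int p"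
        by (metis mod_add_right_eq mod_mult_left_eq)
      also have "\<dots> = ((k x + j * f x) mod int p + i * f x) mod int p"
        by (simp add: mod_simps algebra_simps)
      finally show ?thesis .
    qed
    then show "restrict (\<lambda>c. (k c + (i \<otimes>\<^bsub>integer_mod_group p\<^esub> j) * f c) mod int p) (carrier P) =
        restrict (\<lambda>c. (restrict (\<lambda>c. (k c + j * f c) mod int p) (carrier P) c + i * f c) mod int p) (carrier P)"
      by (auto simp: fun_eq_iff)
  qed (use p finK in auto)
  also have "{k \<in> K. \<exists>j\<in>carrier (integer_mod_group p).
      restrict (\<lambda>c. (k c + j * f c) mod int p) (carrier P) \<noteq> k} = K"
  proof -
    have "restrict (\<lambda>c. (k c + 1 * f c) mod int p) (carrier P) \<noteq> k" if k: "k \<in> K" for k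
    proof
      assume "restrict (\<lambda>c. (k c + 1 * f c) mod int p) (carrier P) = k"
      from fun_cong[OF this, of c] have "(k c + f c) mod int p = k c" using c by simp
      also have "k c = k c mod int p" using range[OF k c] by simp
      finally have "int p dvd k c + f c - k c" by (simp only: mod_eq_dvd_iff)
      with fc show False by simp
    qed
    moreover have "1 \<in> carrier (integer_mod_group p)"
      using p1 by (simp add: carrier_integer_mod_group)
    ultimately show ?thesis by blast
  qed
  finally have dvd1: "p dvd card K" .

  define zero where "zero = restrict (\<lambda>_. 0::int) (carrier P)"
  \<comment> \<open>Right translation moves every point of \<open>K\<close> except \<open>0\<close>.\<close>
  have "p dvd card {k \<in> K. \<exists>g\<in>carrier P. restrict (\<lambda>c. k (c \<otimes> g)) (carrier P) \<noteq> k}"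
  proof (rule p_group_dvd_card_moved_points_of_maps[OF is_group p n finK])
    fix g k assume g: "g \<in> carrier P" and k: "k \<in> K"
    have "T (restrict (\<lambda>c. k (c \<otimes> g)) (carrier P)) d = T k (d \<otimes> g)" if "d \<in> carrier P" for d
      unfolding T_def using u g that by (intro sum.cong) (auto simp: m_assoc)
    then show "restrict (\<lambda>c. k (c \<otimes> g)) (carrier P) \<in> K"
      using g k by (auto simp: K_def Pi_def PiE_def)
  next
    fix k assume k: "k \<in> K"
    have "restrict (\<lambda>c. k (c \<otimes> \<one>)) (carrier P) = restrict k (carrier P)"
      by (rule restrict_ext) simp
    then show "restrict (\<lambda>c. k (c \<otimes> \<one>)) (carrier P) = k"
      using ext[OF k] by simp
  qed (auto simp: m_assoc fun_eq_iff)
  also have "{k \<in> K. \<exists>g\<in>carrier P. restrict (\<lambda>c. k (c \<otimes> g)) (carrier P) \<noteq> k} = K - {zero}"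
  proof (intro Set.set_eqI iffI)
    fix k assume k: "k \<in> K - {zero}"
    have "\<exists>g\<in>carrier P. restrict (\<lambda>c. k (c \<otimes> g)) (carrier P) \<noteq> k"
    proof (rule ccontr)
      assume "\<not> ?thesis"
      then have inv: "restrict (\<lambda>c. k (c \<otimes> g)) (carrier P) = k" if "g \<in> carrier P" for g
        using that by blast
      have const: "k g = k \<one>" if g: "g \<in> carrier P" for g
      proof -
        have "k \<one> = restrict (\<lambda>c. k (c \<otimes> g)) (carrier P) \<one>"
          by (simp only: inv[OF g])
        then show ?thesis using g by simp
      qed
      have "T k \<one> = (\<Sum>i\<in>I. a i) * k \<one>"
        unfolding T_def sum_distrib_right using u by (intro sum.cong) (auto intro!: const)
      moreover have "int p dvd T k \<one>" using k by (simp add: K_def)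
      ultimately have "int p dvd (\<Sum>i\<in>I. a i) * k \<one>" by simp
      then have "int p dvd k \<one>" using unit p by (auto simp: prime_dvd_mult_iff)
      moreover have "0 \<le> k \<one>" "k \<one> < int p" using range[of k \<one>] k by simp_all
      ultimately have k1: "k \<one> = 0" using zdvd_not_zless[of "k \<one>" "int p"] by linarith
      have "restrict k (carrier P) = zero"
        unfolding zero_def using const k1 by (intro restrict_ext) metis
      then have "k = zero" using ext[of k] k by simp
      then show False using k by simp
    qed
    then show "k \<in> {k \<in> K. \<exists>g\<in>carrier P. restrict (\<lambda>c. k (c \<otimes> g)) (carrier P) \<noteq> k}"
      using k by simp
  next
    fix k assume "k \<in> {k \<in> K. \<exists>g\<in>carrier P. restrict (\<lambda>c. k (c \<otimes> g)) (carrier P) \<noteq> k}"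
    then have "k \<in> K" and "\<exists>g\<in>carrier P. restrict (\<lambda>c. k (c \<otimes> g)) (carrier P) \<noteq> k" by auto
    moreover have "restrict (\<lambda>c. zero (c \<otimes> g)) (carrier P) = zero" if "g \<in> carrier P" for g
      unfolding zero_def using that by (intro restrict_ext) simp
    ultimately show "k \<in> K - {zero}" by blast
  qed
  finally have dvd2: "p dvd card (K - {zero})" .
  have "zero \<in> K"
    using p1 u by (auto simp: K_def T_def zero_def)
  then have "card K = Suc (card (K - {zero}))" using finK by (metis card.remove)
  then have "p dvd card (K - {zero}) + 1" using dvd1 by simp
  then have "p dvd 1" using dvd2 by (simp only: dvd_add_right_iff)
  with p1 show False by simp
qed

section \<open>Finite p-quotients separating finitely many elements\<close>

lemma finite_p_group_if_inj_hom:
  assumes "group_hom Q P h" "inj_on h (carrier Q)" "prime p" "finite_p_group p P"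
  shows "finite_p_group p Q"
proof -
  interpret group_hom Q P h by fact
  obtain n where n: "order P = p ^ n" and fin: "finite (carrier P)"
    using assms(4) by (auto simp: finite_p_group_def)
  have "finite (h ` carrier Q)"
    using fin by (rule finite_subset[rotated]) auto
  then have "finite (carrier Q)"
    using assms(2) by (rule finite_imageD)
  have "card (h ` carrier Q) dvd order P"
    using H.lagrange[OF img_is_subgroup] by (metis dvd_triv_right)
  then have "order Q dvd p ^ n"
    using assms(2) by (simp add: order_def card_image flip: n)
  then obtain i where "order Q = p ^ i"
    using assms(3) divides_primepow_nat by blast
  then show ?thesis
    using \<open>finite (carrier Q)\<close> by (auto simp: finite_p_group_def G.is_group)
qed

lemma finite_p_group_Mod_kernel:
  assumes "group_hom G P h" "prime p" "finite_p_group p P"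
  shows "finite_p_group p (G Mod kernel G P h)"
proof -
  interpret group_hom G P h by fact
  have "group_hom (G Mod kernel G P h) P (\<lambda>X. the_elem (h ` X))"
    using FactGroup_hom normal.factorgroup_is_group[OF normal_kernel]
    by (simp add: group_hom_def group_hom_axioms_def)
  then show ?thesis
    using FactGroup_inj_on assms(2,3) by (rule finite_p_group_if_inj_hom)
qed

text \<open>
  \<open>N \<inter> M\<close> is the kernel of the homomorphism to \<open>G Mod N \<times>\<times> G Mod M\<close>, so its quotient embeds
  into a finite \<open>p\<close>-group.
\<close>
lemma (in group) normal_Int_finite_p_group_Mod:
  assumes N: "N \<lhd> G" "finite_p_group p (G Mod N)" and M: "M \<lhd> G" "finite_p_group p (G Mod M)"
    and "prime p"
  shows "N \<inter> M \<lhd> G \<and> finite_p_group p (G Mod (N \<inter> M))"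
proof -
  let ?P = "(G Mod N) \<times>\<times> (G Mod M)" and ?h = "\<lambda>g. (N #> g, M #> g)"
  have groups: "group (G Mod N)" "group (G Mod M)"
    using N M by (simp_all add: normal.factorgroup_is_group)
  have hom: "group_hom G ?P ?h"
    using N(1) M(1) groups normal.r_coset_hom_Mod[of N G] normal.r_coset_hom_Mod[of M G]
    by (auto simp: group_hom_def group_hom_axioms_def hom_pairwise o_def DirProd_group is_group)
  obtain n m where "order (G Mod N) = p ^ n" "order (G Mod M) = p ^ m"
    using N M by (auto simp: finite_p_group_def)
  then have "order ?P = p ^ (n + m)"
    by (simp add: order_def card_cartesian_product power_add)
  then have P: "finite_p_group p ?P"
    using N M groups by (auto simp: finite_p_group_def DirProd_group)
  have mem_iff: "K #> g = K \<longleftrightarrow> g \<in> K" if "K \<lhd> G" "g \<in> carrier G" for K g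
    using that coset_join1[of K g] coset_join2[of g K] normal_imp_subgroup[of K G] subgroup.subset[of K G] by blast
  have "kernel G ?P ?h = N \<inter> M"
    using mem_iff[OF N(1)] mem_iff[OF M(1)] normal_imp_subgroup[OF N(1)] subgroup.subset[of N G]
    by (auto simp: kernel_def FactGroup_def)
  then show ?thesis
    using group_hom.normal_kernel[OF hom] finite_p_group_Mod_kernel[OF hom \<open>prime p\<close> P] by simp
qed

lemma residually_finite_p_group_avoid_finite:
  fixes G (structure)
  assumes G: "residually_finite_p_group p G" and p: "prime p"
    and S: "finite S" "S \<subseteq> carrier G" "\<one> \<notin> S"
  obtains N where "N \<lhd> G" "N \<inter> S = {}" "finite_p_group p (G Mod N)"
proof -
  interpret group G using G by (simp add: residually_finite_p_group_def)
  have "\<exists>N. N \<lhd> G \<and> N \<inter> S = {} \<and> finite_p_group p (G Mod N)"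
    using S
  proof (induction S rule: finite_induct)
    case empty
    have "carrier G \<lhd> G" by (simp add: normal_inv_iff subgroup_self)
    have "rcosets (carrier G) = {carrier G}"
      by (auto simp: RCOSETS_def coset_join2 subgroup_self)
    then have "carrier (G Mod carrier G) = {carrier G}" by (simp add: FactGroup_def)
    moreover have "group (G Mod carrier G)"
      using \<open>carrier G \<lhd> G\<close> by (rule normal.factorgroup_is_group)
    ultimately have "finite_p_group p (G Mod carrier G)"
      by (auto simp: finite_p_group_def order_def intro!: exI[of _ 0])
    with \<open>carrier G \<lhd> G\<close> show ?case by auto
  next
    case (insert g S)
    then obtain N where N: "N \<lhd> G" "N \<inter> S = {}" "finite_p_group p (G Mod N)" by auto
    obtain M where M: "M \<lhd> G" "g \<notin> M" "finite_p_group p (G Mod M)"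
      using G insert.prems by (auto simp: residually_finite_p_group_def)
    have "N \<inter> M \<inter> insert g S = {}" using N M by auto
    then show ?case
      using normal_Int_finite_p_group_Mod[OF N(1,3) M(1,3) p] by blast
  qed
  then show thesis using that by blast
qed

section \<open>Reduction modulo p for residually finite p-groups\<close>

text \<open>
  Left multiplication by \<open>x\<close> maps the fibre of \<open>h\<close> over \<open>inv\<^bsub>H\<^esub> (h x) \<otimes>\<^bsub>H\<^esub> c\<close> onto the fibre over \<open>c\<close>.
  So translation by \<open>x\<close> becomes translation by \<open>h x\<close> when functions are pushed forward along \<open>h\<close> by
  summing over its fibres.
\<close>
lemma (in group_hom) sum_fibre_translate:
  fixes b :: "'a \<Rightarrow> 'k::comm_monoid_add"
  assumes "finite B" "B \<subseteq> carrier G" "\<And>y. y \<notin> B \<Longrightarrow> b y = 0"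
    and "finite Y" "Y \<subseteq> carrier G" and x: "x \<in> carrier G" and "(\<lambda>y. x \<otimes> y) ` B \<subseteq> Y"
    and c: "c \<in> carrier H"
  shows "(\<Sum>g\<in>{g \<in> Y. h g = c}. b (inv x \<otimes> g)) = (\<Sum>y\<in>{y \<in> B. h y = inv\<^bsub>H\<^esub> (h x) \<otimes>\<^bsub>H\<^esub> c}. b y)"
proof (rule sum.reindex_bij_witness_not_neutral[where S' = "{g \<in> Y. h g = c \<and> inv x \<otimes> g \<notin> B}" and T' = "{}"
    and j = "\<lambda>g. inv x \<otimes> g" and i = "\<lambda>y. x \<otimes> y"])
  fix y assume "y \<in> {y \<in> B. h y = inv\<^bsub>H\<^esub> (h x) \<otimes>\<^bsub>H\<^esub> c} - {}"
  then have y: "y \<in> B" "y \<in> carrier G" "h y = inv\<^bsub>H\<^esub> (h x) \<otimes>\<^bsub>H\<^esub> c" using assms(2) by auto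
  then show "inv x \<otimes> (x \<otimes> y) = y"
    using x by (simp flip: G.m_assoc)
  then show "x \<otimes> y \<in> {g \<in> Y. h g = c} - {g \<in> Y. h g = c \<and> inv x \<otimes> g \<notin> B}"
    using x y c assms(7) by (auto simp flip: H.m_assoc)
qed (use assms in \<open>auto simp: subset_iff simp flip: G.m_assoc\<close>)

text \<open>
  Choose a finite \<open>p\<close>-quotient in which \<open>g\<close> is separated from the rest of the support of \<open>b\<close>. The
  push-forward of \<open>b\<close> takes the value \<open>b g\<close> at the image of \<open>g\<close>, and it is annihilated modulo \<open>p\<close>
  by an element of augmentation prime to \<open>p\<close>, hence divisible by \<open>p\<close>.
\<close>
lemma residually_finite_p_group_dvd_of_annihilated:
  fixes G (structure) and a b :: "'a \<Rightarrow> int"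
  assumes G: "residually_finite_p_group p G" and p: "prime p"
    and X: "finite X" "X \<subseteq> carrier G" and b: "finite (supp b)" "supp b \<subseteq> carrier G"
    and unit: "\<not> int p dvd (\<Sum>x\<in>X. a x)"
    and conv: "\<And>g. g \<in> carrier G \<Longrightarrow> int p dvd (\<Sum>x\<in>X. a x * b (inv x \<otimes> g))"
    and g: "g \<in> carrier G"
  shows "int p dvd b g"
proof -
  interpret group G using G by (simp add: residually_finite_p_group_def)
  define S where "S = (\<lambda>y. y \<otimes> inv g) ` (supp b - {g})"
  have "\<one> \<notin> S"
  proof
    assume "\<one> \<in> S"
    then obtain y where y: "\<one> = y \<otimes> inv g" "y \<in> supp b - {g}"
      unfolding S_def by (rule imageE)
    then have "y = g" using g b inv_equality[of y "inv g"] by auto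
    with y show False by simp
  qed
  moreover have "finite S" "S \<subseteq> carrier G" using b g by (auto simp: S_def)
  ultimately obtain N where N: "N \<lhd> G" "N \<inter> S = {}" "finite_p_group p (G Mod N)"
    using residually_finite_p_group_avoid_finite[OF G p] by blast
  have NG: "N \<subseteq> carrier G" "subgroup N G"
    using normal_imp_subgroup[OF N(1)] by (auto dest: subgroup.subset)
  define P where "P = G Mod N"
  define h where "h x = N #> x" for x
  interpret h: group_hom G P h
    using normal.r_coset_hom_Mod[OF N(1)] N(1) unfolding P_def h_def
    by (simp add: group_hom_def group_hom_axioms_def is_group normal.factorgroup_is_group)
  define b' where "b' c = (\<Sum>y\<in>{y \<in> supp b. h y = c}. b y)" for c
  define Y where "Y = (\<lambda>(x, y). x \<otimes> y) ` (X \<times> supp b)"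
  have Y: "finite Y" "Y \<subseteq> carrier G" using X b by (auto simp: Y_def)
  have "int p dvd b' (h g)"
  proof (rule finite_p_group_dvd_of_translates[OF p, where u = h and I = X and a = a])
    show "finite_p_group p P" using N by (simp add: P_def)
    show "h x \<in> carrier P" if "x \<in> X" for x using that X by auto
    show "\<not> int p dvd (\<Sum>x\<in>X. a x)" by (rule unit)
    show "h g \<in> carrier P" using g by simp
    fix c assume c: "c \<in> carrier P"
    have "(\<Sum>x\<in>X. a x * b' (inv\<^bsub>P\<^esub> (h x) \<otimes>\<^bsub>P\<^esub> c)) =
        (\<Sum>x\<in>X. \<Sum>g\<in>{g \<in> Y. h g = c}. a x * b (inv x \<otimes> g))"
    proof (rule sum.cong[OF refl])
      fix x assume "x \<in> X"
      then have x: "x \<in> carrier G" "(\<lambda>y. x \<otimes> y) ` supp b \<subseteq> Y" using X by (auto simp: Y_def)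
      have b0: "b y = 0" if "y \<notin> supp b" for y using that by (simp add: supp_def)
      have "(\<Sum>g\<in>{g \<in> Y. h g = c}. b (inv x \<otimes> g)) = b' (inv\<^bsub>P\<^esub> (h x) \<otimes>\<^bsub>P\<^esub> c)"
        unfolding b'_def by (rule h.sum_fibre_translate[OF b b0 Y x c])
      then show "a x * b' (inv\<^bsub>P\<^esub> (h x) \<otimes>\<^bsub>P\<^esub> c) = (\<Sum>g\<in>{g \<in> Y. h g = c}. a x * b (inv x \<otimes> g))"
        by (simp only: sum_distrib_left[symmetric])
    qed
    also have "\<dots> = (\<Sum>g\<in>{g \<in> Y. h g = c}. \<Sum>x\<in>X. a x * b (inv x \<otimes> g))"
      by (rule sum.swap)
    finally show "int p dvd (\<Sum>x\<in>X. a x * b' (inv\<^bsub>P\<^esub> (h x) \<otimes>\<^bsub>P\<^esub> c))"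
      using Y by (simp only:, intro dvd_sum conv) auto
  qed
  also have "b' (h g) = b g"
  proof -
    have "y = g" if y: "y \<in> supp b" "h y = h g" for y
    proof (rule ccontr)
      assume "y \<noteq> g"
      then have "y \<otimes> inv g \<in> S" using y by (auto simp: S_def)
      moreover have "y \<in> N #> g"
        using y b rcos_self[OF _ NG(2), of y] by (auto simp: h_def)
      then have "y \<otimes> inv g \<in> N"
        using subgroup.rcos_module_imp[OF NG(2) is_group g] by blast
      ultimately show False using N by blast
    qed
    then have "{y \<in> supp b. h y = h g} = (if g \<in> supp b then {g} else {})" by auto
    then show ?thesis by (simp add: b'_def supp_def)
  qed
  finally show ?thesis .
qed

section \<open>Short elements modulo a prime in torsion-free groups\<close>

text \<open>
  Modulo \<open>q\<close> only the terms of \<open>a\<close> with coefficient prime to \<open>q\<close> remain. A single term acts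
  invertibly. If two terms at \<open>x\<close> and \<open>y\<close> annihilate \<open>b\<close>, then the support of \<open>b\<close> modulo \<open>q\<close> is
  stable under left multiplication by \<open>inv y \<otimes> x\<close>; this element has infinite order, so the
  support would be infinite.
\<close>
lemma torsion_free_card_coprime_coeffs:
  fixes G (structure) and a b :: "'a \<Rightarrow> int"
  assumes "group G" and tf: "torsion_free G" and q: "prime q"
    and X: "finite X" "X \<subseteq> carrier G" and b: "finite (supp b)" "supp b \<subseteq> carrier G"
    and conv: "\<And>g. g \<in> carrier G \<Longrightarrow> q dvd (\<Sum>x\<in>X. a x * b (inv x \<otimes> g))"
    and nz: "\<not> q dvd b g0"
  shows "card {x \<in> X. \<not> q dvd a x} \<noteq> 1" "card {x \<in> X. \<not> q dvd a x} \<noteq> 2"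
proof -
  interpret group G by fact
  define A where "A = {x \<in> X. \<not> q dvd a x}"
  define S where "S = {y. \<not> q dvd b y}"
  have "S \<subseteq> supp b" by (auto simp: S_def supp_def)
  then have S: "finite S" "S \<subseteq> carrier G" using b by (auto intro: finite_subset)
  have g0: "g0 \<in> S" "g0 \<in> carrier G" using nz S by (auto simp: S_def)
  have convA: "q dvd (\<Sum>x\<in>A. a x * b (inv x \<otimes> g))" if "g \<in> carrier G" for g
  proof -
    have "(\<Sum>x\<in>X. a x * b (inv x \<otimes> g)) =
        (\<Sum>x\<in>X - A. a x * b (inv x \<otimes> g)) + (\<Sum>x\<in>A. a x * b (inv x \<otimes> g))"
      using X(1) by (intro sum.subset_diff) (auto simp: A_def)
    moreover have "q dvd (\<Sum>x\<in>X - A. a x * b (inv x \<otimes> g))"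
      by (intro dvd_sum) (auto simp: A_def)
    ultimately show ?thesis using conv[OF that] by (simp add: dvd_add_right_iff)
  qed
  have cancel: "inv x \<otimes> (x \<otimes> y) = y" if "x \<in> carrier G" "y \<in> carrier G" for x y
    using that by (simp flip: m_assoc)
  show "card {x \<in> X. \<not> q dvd a x} \<noteq> 1"
  proof
    assume "card {x \<in> X. \<not> q dvd a x} = 1"
    then obtain x where x: "A = {x}" by (auto simp: A_def card_1_singleton_iff)
    then have "x \<in> X" "\<not> q dvd a x" by (auto simp: A_def)
    then show False
      using convA[of "x \<otimes> g0"] x X g0 q nz by (auto simp: cancel prime_dvd_mult_iff)
  qed
  show "card {x \<in> X. \<not> q dvd a x} \<noteq> 2"
  proof
    assume "card {x \<in> X. \<not> q dvd a x} = 2"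
    then obtain x y where xy: "A = {x, y}" "x \<noteq> y" by (auto simp: A_def card_2_iff)
    then have "x \<in> X" "y \<in> X" "\<not> q dvd a x" "\<not> q dvd a y" by (auto simp: A_def)
    then have x: "x \<in> carrier G" "\<not> q dvd a x" and y: "y \<in> carrier G" "\<not> q dvd a y"
      using X by auto
    define t where "t = inv y \<otimes> x"
    have t: "t \<in> carrier G" using x y by (simp add: t_def)
    have "t \<noteq> \<one>"
      using x y xy(2) by (metis inv_closed inv_equality inv_inv t_def)
    have step: "t \<otimes> g \<in> S" if "g \<in> S" for g
    proof -
      have g: "g \<in> carrier G" "\<not> q dvd b g" using that S by (auto simp: S_def)
      have "q dvd a x * b g + a y * b (t \<otimes> g)"
        using convA[of "x \<otimes> g"] x y g xy by (simp add: cancel t_def m_assoc)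
      moreover have "\<not> q dvd a x * b g" using q x g by (simp add: prime_dvd_mult_iff)
      ultimately have "\<not> q dvd a y * b (t \<otimes> g)" by (metis dvd_add_left_iff)
      then show ?thesis by (auto simp: S_def)
    qed
    have "t [^] n \<otimes> g0 \<in> S" for n :: nat
    proof (induction n)
      case (Suc n)
      have "t [^] Suc n \<otimes> g0 = t \<otimes> (t [^] n \<otimes> g0)"
        using t g0 by (simp only: nat_pow_Suc2[OF t] m_assoc nat_pow_closed)
      with step[OF Suc] show ?case by simp
    qed (use g0 in simp)
    then have "range (\<lambda>n::nat. t [^] n \<otimes> g0) \<subseteq> S" by auto
    then have "finite (range (\<lambda>n::nat. t [^] n \<otimes> g0))" using S(1) by (rule finite_subset)
    moreover have "inj (\<lambda>n::nat. t [^] n \<otimes> g0)"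
    proof (rule linorder_injI)
      fix m n :: nat assume "m < n"
      show "t [^] m \<otimes> g0 \<noteq> t [^] n \<otimes> g0"
      proof
        assume "t [^] m \<otimes> g0 = t [^] n \<otimes> g0"
        then have "t [^] m = t [^] n" using t g0 by simp
        moreover have "t [^] m \<otimes> t [^] (n - m) = t [^] n"
          using t \<open>m < n\<close> by (simp add: nat_pow_mult)
        ultimately have "t [^] m \<otimes> \<one> = t [^] m \<otimes> t [^] (n - m)" using t by simp
        then have "t [^] (n - m) = \<one>" using t by simp
        moreover have "n - m > 0" using \<open>m < n\<close> by simp
        ultimately show False using tf t \<open>t \<noteq> \<one>\<close> unfolding torsion_free_def by blast
      qed
    qed
    ultimately show False by (metis finite_imageD infinite_UNIV_nat)
  qed
qed

section \<open>From rational to primitive integer coefficients\<close>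

lemma primitive_integer_multiple:
  fixes \<alpha> :: "'g \<Rightarrow> rat"
  assumes fin: "finite (supp \<alpha>)" and nz: "\<alpha> \<noteq> (\<lambda>x. 0)"
  obtains r and a :: "'g \<Rightarrow> int" where "r \<noteq> 0" "\<alpha> = (\<lambda>x. r * of_int (a x))" "Gcd (range a) = 1"
proof -
  define D where "D = (\<Prod>x\<in>supp \<alpha>. snd (quotient_of (\<alpha> x)))"
  have D: "D \<noteq> 0"
    unfolding D_def using quotient_of_denom_pos' by (simp add: fin less_imp_neq[symmetric])
  have "\<exists>c::int. \<alpha> x * of_int D = of_int c" for x
  proof (cases "x \<in> supp \<alpha>")
    case True
    let ?n = "fst (quotient_of (\<alpha> x))" and ?d = "snd (quotient_of (\<alpha> x))"
    have "\<alpha> x = of_int ?n / of_int ?d" by (rule quotient_of_div) simp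
    moreover have "?d \<noteq> 0" using quotient_of_denom_pos'[of "\<alpha> x"] by simp
    moreover have "?d dvd D" unfolding D_def using fin True by (rule dvd_prodI)
    then obtain e where "D = ?d * e" by (rule dvdE)
    ultimately have "\<alpha> x * of_int D = of_int (?n * e)" by (simp add: field_simps)
    then show ?thesis by blast
  qed (auto simp: supp_def intro: exI[of _ 0])
  then obtain c :: "'g \<Rightarrow> int" where c: "\<And>x. \<alpha> x * of_int D = of_int (c x)" by metis
  define g where "g = Gcd (range c)"
  have "\<exists>x. c x \<noteq> 0" using nz c D by (auto simp: fun_eq_iff) (metis mult_eq_0_iff of_int_0_eq_iff)
  then have g: "g > 0" unfolding g_def by (auto simp: less_le Gcd_0_iff)
  define a where "a x = c x div g" for x
  have ca: "c x = g * a x" for x unfolding a_def g_def by (simp add: Gcd_dvd)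
  have "g = Gcd (range c)" by (rule g_def)
  also have "range c = (*) g ` range a" unfolding image_image by (simp only: ca[symmetric])
  finally have "g * 1 = g * Gcd (range a)" using g by (simp add: Gcd_mult normalize_mult)
  then have "Gcd (range a) = 1" using g by simp
  moreover have "\<alpha> = (\<lambda>x. (of_int g / of_int D) * of_int (a x))"
  proof
    fix x
    show "\<alpha> x = of_int g / of_int D * of_int (a x)" using c[of x] ca[of x] D by (simp add: field_simps)
  qed
  moreover have "(of_int g / of_int D :: rat) \<noteq> 0" using g D by simp
  ultimately show thesis using that by blast
qed

lemma Gcd_range_eq_1_prime:
  fixes a :: "'g \<Rightarrow> int"
  assumes "Gcd (range a) = 1" "prime q"
  obtains x where "\<not> q dvd a x"
proof -
  have "\<not> (\<forall>x. q dvd a x)"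
  proof
    assume "\<forall>x. q dvd a x"
    then have "q dvd Gcd (range a)" by (intro Gcd_greatest) auto
    with assms show False by (simp add: not_prime_unit)
  qed
  with that show thesis by blast
qed

lemma group_algebra_mult_eq_sum:
  fixes G (structure) and \<alpha> \<beta> :: "'g \<Rightarrow> 'k::field"
  assumes "group G" and a: "\<alpha> \<in> carrier (group_algebra G)" and b: "\<beta> \<in> carrier (group_algebra G)"
    and g: "g \<in> carrier G"
  shows "(\<alpha> \<otimes>\<^bsub>group_algebra G\<^esub> \<beta>) g = (\<Sum>x\<in>supp \<alpha>. \<alpha> x * \<beta> (inv x \<otimes> g))"
  unfolding group_algebra_simps(2)
proof (rule sum.cong[OF refl])
  interpret group G by fact
  fix x assume "x \<in> supp \<alpha>"
  then have x: "x \<in> carrier G" using a by (auto simp: group_algebra_simps)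
  have fin: "finite (supp \<beta>)" and sub: "supp \<beta> \<subseteq> carrier G"
    using b by (auto simp: group_algebra_simps)
  have "x \<otimes> y = g \<longleftrightarrow> y = inv x \<otimes> g" if "y \<in> supp \<beta>" for y
    using that sub x g by (auto simp flip: m_assoc)
  then have "(\<Sum>y\<in>supp \<beta>. if x \<otimes> y = g then \<alpha> x * \<beta> y else 0) =
      (\<Sum>y\<in>supp \<beta>. if y = inv x \<otimes> g then \<alpha> x * \<beta> y else 0)"
    by (intro sum.cong refl) simp
  also have "\<dots> = \<alpha> x * \<beta> (inv x \<otimes> g)"
    using fin by (simp add: supp_def)
  finally show "(\<Sum>y\<in>supp \<beta>. if x \<otimes> y = g then \<alpha> x * \<beta> y else 0) = \<alpha> x * \<beta> (inv x \<otimes> g)" .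
qed

text \<open>
  The annihilated element is rescaled to be primitive, so that it stays nonzero modulo every prime
  at once; this is what makes the two reductions modulo primes applicable.
\<close>
lemma zero_divisor_primitive_annihilator:
  fixes G (structure) and a :: "'g \<Rightarrow> int" and r :: rat
  assumes "group G" and r: "r \<noteq> 0" and zd: "zero_divisor (group_algebra G) (\<lambda>x. r * of_int (a x))"
  obtains b :: "'g \<Rightarrow> int" where "finite (supp b)" "supp b \<subseteq> carrier G" "Gcd (range b) = 1"
    "\<And>g. g \<in> carrier G \<Longrightarrow> (\<Sum>x\<in>supp a. a x * b (inv x \<otimes> g)) = 0"
proof -
  let ?\<alpha> = "\<lambda>x. r * of_int (a x)"
  obtain \<beta> :: "'g \<Rightarrow> rat" where \<alpha>: "?\<alpha> \<in> carrier (group_algebra G)"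
    and \<beta>: "\<beta> \<in> carrier (group_algebra G)" "\<beta> \<noteq> (\<lambda>x. 0)"
    and prod: "?\<alpha> \<otimes>\<^bsub>group_algebra G\<^esub> \<beta> = (\<lambda>x. 0)"
    using zd by (auto simp: zero_divisor_def group_algebra_simps(4))
  have "finite (supp \<beta>)" using \<beta>(1) by (simp add: group_algebra_simps)
  then obtain s b where s: "s \<noteq> 0" and b: "\<beta> = (\<lambda>x. s * of_int (b x))" "Gcd (range b) = 1"
    using \<beta>(2) by (rule primitive_integer_multiple)
  have supp: "supp ?\<alpha> = supp a" "supp \<beta> = supp b"
    using r s by (auto simp: supp_def b)
  have "(\<Sum>x\<in>supp a. a x * b (inv x \<otimes> g)) = 0" if g: "g \<in> carrier G" for g
  proof -
    have "(?\<alpha> \<otimes>\<^bsub>group_algebra G\<^esub> \<beta>) g = r * s * of_int (\<Sum>x\<in>supp a. a x * b (inv x \<otimes> g))"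
      unfolding group_algebra_mult_eq_sum[OF assms(1) \<alpha> \<beta>(1) g] supp
      by (simp add: b sum_distrib_left mult_ac)
    then have "r * s * of_int (\<Sum>x\<in>supp a. a x * b (inv x \<otimes> g)) = 0" by (simp add: prod)
    then show ?thesis using r s by (simp only: mult_eq_0_iff of_int_eq_0_iff) simp
  qed
  moreover have "finite (supp b)" "supp b \<subseteq> carrier G"
    using \<beta>(1) supp by (auto simp: group_algebra_simps)
  ultimately show thesis using that b(2) by blast
qed

section \<open>Constraints on the coefficients of a zero divisor\<close>

lemma zero_divisor_prime_dvd_augmentation:
  fixes G (structure) and a :: "'g \<Rightarrow> int" and r :: rat
  assumes G: "residually_finite_p_group p G" and p: "prime p"
    and r: "r \<noteq> 0" and zd: "zero_divisor (group_algebra G) (\<lambda>x. r * of_int (a x))"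
  shows "int p dvd (\<Sum>x\<in>supp a. a x)"
proof (rule ccontr)
  assume unit: "\<not> int p dvd (\<Sum>x\<in>supp a. a x)"
  have "group G" using G by (simp add: residually_finite_p_group_def)
  then obtain b where b: "finite (supp b)" "supp b \<subseteq> carrier G" "Gcd (range b) = 1"
    and conv: "\<And>g. g \<in> carrier G \<Longrightarrow> (\<Sum>x\<in>supp a. a x * b (inv x \<otimes> g)) = 0"
    using zero_divisor_primitive_annihilator r zd by blast
  have "supp (\<lambda>x. r * of_int (a x)) = supp a" using r by (auto simp: supp_def)
  then have a: "finite (supp a)" "supp a \<subseteq> carrier G"
    using zd by (auto simp: zero_divisor_def group_algebra_simps(1))
  have "prime (int p)" using p by simp
  then obtain g where g: "\<not> int p dvd b g" using Gcd_range_eq_1_prime b(3) by blast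
  then have "g \<in> carrier G" using b(2) by (auto simp: supp_def)
  then have "int p dvd b g"
    using residually_finite_p_group_dvd_of_annihilated[OF G p a b(1,2) unit] conv by simp
  with g show False by simp
qed

lemma zero_divisor_card_coprime_coeffs:
  fixes G (structure) and a :: "'g \<Rightarrow> int" and r :: rat
  assumes "group G" "torsion_free G" "prime q"
    and r: "r \<noteq> 0" and zd: "zero_divisor (group_algebra G) (\<lambda>x. r * of_int (a x))"
  shows "card {x \<in> supp a. \<not> q dvd a x} \<noteq> 1" "card {x \<in> supp a. \<not> q dvd a x} \<noteq> 2"
proof -
  obtain b where b: "finite (supp b)" "supp b \<subseteq> carrier G" "Gcd (range b) = 1"
    and conv: "\<And>g. g \<in> carrier G \<Longrightarrow> (\<Sum>x\<in>supp a. a x * b (inv x \<otimes> g)) = 0"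
    using zero_divisor_primitive_annihilator assms by blast
  have "supp (\<lambda>x. r * of_int (a x)) = supp a" using r by (auto simp: supp_def)
  then have a: "finite (supp a)" "supp a \<subseteq> carrier G"
    using zd by (auto simp: zero_divisor_def group_algebra_simps(1))
  obtain g0 where "\<not> q dvd b g0" using Gcd_range_eq_1_prime b(3) assms(3) by blast
  then show "card {x \<in> supp a. \<not> q dvd a x} \<noteq> 1" "card {x \<in> supp a. \<not> q dvd a x} \<noteq> 2"
    using torsion_free_card_coprime_coeffs[OF assms(1-3) a b(1,2)] conv by simp_all
qed

text \<open>
  A prime dividing one of the three coefficients would leave, modulo that prime, one or two terms:
  not none, because the coefficients have no common factor. Both cases are excluded. So no prime
  divides any coefficient.
\<close>
lemma torsion_free_zero_divisor_card_supp_3_coeffs: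
  fixes G (structure) and a :: "'g \<Rightarrow> int" and r :: rat
  assumes "group G" "torsion_free G" and r: "r \<noteq> 0"
    and zd: "zero_divisor (group_algebra G) (\<lambda>x. r * of_int (a x))"
    and "Gcd (range a) = 1" "card (supp a) = 3" and x: "x \<in> supp a"
  shows "\<bar>a x\<bar> = 1"
proof (rule ccontr)
  assume "\<bar>a x\<bar> \<noteq> 1"
  then obtain q where q: "prime q" "q dvd a x"
    using prime_divisor_exists[of "a x"] x by (auto simp: supp_def)
  define A where "A = {y \<in> supp a. \<not> q dvd a y}"
  have fin: "finite (supp a)" using assms(6) by (metis card.infinite zero_neq_numeral)
  have "A \<subset> supp a" using x q by (auto simp: A_def)
  then have "card A < 3" using psubset_card_mono[OF fin] assms(6) by simp
  moreover obtain y where "\<not> q dvd a y" using Gcd_range_eq_1_prime assms(5) q by blast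
  then have "y \<in> A" by (auto simp: A_def supp_def)
  then have "card A \<noteq> 0" using fin by (auto simp: A_def)
  moreover have "card A \<noteq> 1" "card A \<noteq> 2"
    using zero_divisor_card_coprime_coeffs[OF assms(1,2) q(1) r zd] by (simp_all add: A_def)
  ultimately show False by linarith
qed

theorem theorem1p2:
  fixes G :: "('g, 'm) monoid_scheme"
  assumes "group G"
  shows "(\<forall>p::nat. prime p \<and> p \<noteq> 3 \<and> torsion_free G \<and> residually_finite_p_group p G \<longrightarrow>
            \<not> (\<exists>\<alpha> :: 'g \<Rightarrow> rat. zero_divisor (group_algebra G) \<alpha> \<and> card (supp \<alpha>) = 3))
       \<and> (residually_finite_p_group 3 G \<longrightarrow>
            \<not> (\<exists>h1\<in>carrier G. \<exists>h2\<in>carrier G. \<exists>h3\<in>carrier G.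
                 h1 \<noteq> h2 \<and> h1 \<noteq> h3 \<and> h2 \<noteq> h3 \<and>
                 zero_divisor (group_algebra G :: ('g \<Rightarrow> rat) ring)
                   (basis_elt h1 \<ominus>\<^bsub>group_algebra G\<^esub> basis_elt h2 \<oplus>\<^bsub>group_algebra G\<^esub> basis_elt h3)))"
proof (intro conjI allI impI notI; elim conjE exE bexE)
  fix p :: nat and \<alpha> :: "'g \<Rightarrow> rat"
  assume p: "prime p" "p \<noteq> 3" and G: "torsion_free G" "residually_finite_p_group p G"
    and zd: "zero_divisor (group_algebra G) \<alpha>" and card: "card (supp \<alpha>) = 3"
  have "finite (supp \<alpha>)" "\<alpha> \<noteq> (\<lambda>x. 0)"
    using zd by (auto simp: zero_divisor_def group_algebra_simps)
  then obtain r a where r: "r \<noteq> 0" and a: "\<alpha> = (\<lambda>x. r * of_int (a x))" "Gcd (range a) = 1"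
    by (rule primitive_integer_multiple)
  have "supp \<alpha> = supp a" using r by (auto simp: supp_def a)
  then have card: "card (supp a) = 3" using card by simp
  have "\<bar>a x\<bar> = 1" if "x \<in> supp a" for x
    using torsion_free_zero_divisor_card_supp_3_coeffs[OF assms G(1) r _ a(2) card that] zd a(1) by simp
  then have pm: "a x = 1 \<or> a x = -1" if "x \<in> supp a" for x
    using that by fastforce
  obtain x y z where xyz: "supp a = {x, y, z}" "x \<noteq> y" "x \<noteq> z" "y \<noteq> z"
    using card by (auto simp: card_3_iff)
  \<comment> \<open>Three signs sum to \<open>1\<close> or \<open>3\<close> up to sign, and neither is divisible by a prime other than \<open>3\<close>.\<close>
  have "int p dvd (\<Sum>x\<in>supp a. a x)"
    using zero_divisor_prime_dvd_augmentation[OF G(2) p(1) r] zd a(1) by simp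
  then have "int p dvd a x + a y + a z" using xyz by (simp add: add.assoc)
  moreover have "a x + a y + a z \<in> {3, 1, -1, -3}"
    using pm[of x] pm[of y] pm[of z] xyz by auto
  ultimately have "int p dvd 1 \<or> int p dvd 3" by auto
  then have "p dvd 1 \<or> p dvd 3" by (metis int_dvd_int_iff of_nat_1 of_nat_numeral)
  then show False
    using p primes_dvd_imp_eq[OF p(1), of 3] by (auto simp: not_prime_1)
next
  fix h1 h2 h3
  assume G: "residually_finite_p_group 3 G" and h: "h1 \<in> carrier G" "h2 \<in> carrier G" "h3 \<in> carrier G"
    and ne: "h1 \<noteq> h2" "h1 \<noteq> h3" "h2 \<noteq> h3"
    and zd: "zero_divisor (group_algebra G :: ('g \<Rightarrow> rat) ring)
      (basis_elt h1 \<ominus>\<^bsub>group_algebra G\<^esub> basis_elt h2 \<oplus>\<^bsub>group_algebra G\<^esub> basis_elt h3)"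
  interpret R: abelian_group "group_algebra G :: ('g \<Rightarrow> rat) ring"
    by (rule abelian_group_group_algebra)
  define a :: "'g \<Rightarrow> int" where "a x = (if x = h1 \<or> x = h3 then 1 else if x = h2 then -1 else 0)" for x
  have "\<ominus>\<^bsub>group_algebra G\<^esub> (basis_elt h2 :: 'g \<Rightarrow> rat) = (\<lambda>x. - basis_elt h2 x)"
    by (rule R.minus_equality) (use h in \<open>auto simp: group_algebra_simps supp_def basis_elt_def\<close>)
  then have "basis_elt h1 \<ominus>\<^bsub>group_algebra G\<^esub> basis_elt h2 \<oplus>\<^bsub>group_algebra G\<^esub> basis_elt h3 =
      (\<lambda>x. (1::rat) * of_int (a x))"
    using ne by (auto simp: a_minus_def group_algebra_simps basis_elt_def a_def fun_eq_iff)
  then have "zero_divisor (group_algebra G) (\<lambda>x. (1::rat) * of_int (a x))" using zd by simp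
  from zero_divisor_prime_dvd_augmentation[OF G _ _ this] have "int 3 dvd (\<Sum>x\<in>supp a. a x)"
    by simp
  moreover have "supp a = {h1, h2, h3}" using ne by (auto simp: supp_def a_def)
  ultimately show False using ne by (simp add: a_def)
qed

end
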